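(* Let $N$ be a non-negative integer, $k$ any integer, and $\nu\in\{0,1\}$. Then \[B_{2N+\nu}(k,q) = q^{2k^2-k} \genfrac{[}{]}{0pt}{}{2N+\nu}{N+k}_{q^2}.\]
   Context: A partition $\pi=(\lambda_1,\lambda_2,\dots)$ is a finite non-increasing sequence of positive integers (its parts); the empty sequence is the unique partition of $0$. The parts $\lambda_{2r-1}$ are odd-indexed and the parts $\lambda_{2r}$ even-indexed ($r\ge1$). The BG-rank of $\pi$ is $BG(\pi)=i-j$, where $i$ is the number of odd-indexed parts that are odd and $j$ is the number of even-indexed parts that are odd. $B_N(k,q)$ is the generating function $\sum_\pi q^{|\pi|}$ over all partitions $\pi$ into distinct parts, all $\le N$, with $BG(\pi)=k$, where $|\pi|$ is the sum of the parts of $\pi$. Notation: $(a;q)_L=\prod_{n=0}^{L-1}(1-aq^n)$; $\genfrac{[}{]}{0pt}{}{m}{n}_q=\frac{(q;q)_m}{(q;q)_n(q;q)_{m-n}}$ for $m\ge n\ge0$ and $0$ otherwise; the subscript $q^2$ means $q$ is replaced by $q^2$. *)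

theory Defs
  imports "HOL-Computational_Algebra.Formal_Power_Series"
begin

definition is_partition :: "nat list \<Rightarrow> bool" where
  "is_partition p \<longleftrightarrow> sorted_wrt (\<ge>) p \<and> (\<forall>x\<in>set p. 0 < x)"

text \<open>
  The part \<open>\<lambda>\<^sub>r\<close> of the partition is \<open>p ! (r - 1)\<close>: lists are indexed from 0, so the
  odd-indexed parts \<open>\<lambda>\<^sub>1, \<lambda>\<^sub>3, \<dots>\<close> sit at the even list positions.
\<close>

definition BG_rank :: "nat list \<Rightarrow> int" where
  "BG_rank p = int (card {i. i < length p \<and> even i \<and> odd (p ! i)})
             - int (card {i. i < length p \<and> odd i \<and> odd (p ! i)})"

definition BG_partitions :: "nat \<Rightarrow> int \<Rightarrow> nat list set" where
  "BG_partitions N k =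
     {p. is_partition p \<and> distinct p \<and> (\<forall>x\<in>set p. x \<le> N) \<and> BG_rank p = k}"

text \<open>The generating function below is therefore a genuine finite sum.\<close>

lemma finite_BG_partitions: "finite (BG_partitions N k)"
proof (rule finite_subset)
  show "BG_partitions N k \<subseteq> {p. set p \<subseteq> {..N} \<and> distinct p}"
    by (auto simp: BG_partitions_def)
  show "finite {p. set p \<subseteq> {..N} \<and> distinct p}"
    by (rule finite_subset_distinct) simp
qed

definition BG_gen :: "nat \<Rightarrow> int \<Rightarrow> 'a \<Rightarrow> 'a :: comm_semiring_1" where
  "BG_gen N k q = (\<Sum>p\<in>BG_partitions N k. q ^ sum_list p)"

definition q_pochhammer :: "'a \<Rightarrow> 'a \<Rightarrow> nat \<Rightarrow> 'a :: comm_ring_1" where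
  "q_pochhammer a q L = (\<Prod>n<L. 1 - a * q ^ n)"

text \<open>
  Used with \<open>q\<close> a positive power of the indeterminate in a ring of formal power series over a
  field: the denominator then has constant coefficient 1, so it is a unit and \<open>/\<close> is the true
  quotient.
\<close>

definition q_binomial :: "'a \<Rightarrow> int \<Rightarrow> int \<Rightarrow> 'a :: {comm_ring_1, inverse}" where
  "q_binomial q m n =
     (if 0 \<le> n \<and> n \<le> m
      then q_pochhammer q q (nat m) / (q_pochhammer q q (nat n) * q_pochhammer q q (nat (m - n)))
      else 0)"

end

(* Removing the largest part shifts the parity of the index of every other part, so it turns the
   BG-rank k into [M odd] - k, where M is the part removed. Hence
   B_M(k) = B_(M-1)(k) + q^M B_(M-1)([M odd] - k).
   After the symmetry [m, n] = [m, m - n] is applied to the last term, the right-hand side of the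
   theorem satisfies the same recurrence: for odd and even M it is one or the other of the two
   q-Pascal rules in base q^2. *)

theory Submission
  imports Defs
begin

section \<open>Gaussian binomials and the two q-Pascal rules\<close>

lemma q_pochhammer_0 [simp]: "q_pochhammer a q 0 = 1"
  by (simp add: q_pochhammer_def)

lemma q_pochhammer_self_Suc: "q_pochhammer q q (Suc n) = q_pochhammer q q n * (1 - q ^ Suc n)"
  by (simp add: q_pochhammer_def)

text \<open>Makes every denominator of a q-binomial a unit, hence nonzero and cancellable.\<close>

lemma fps_nth_0_q_pochhammer:
  fixes q :: "'a :: comm_ring_1 fps"
  assumes "fps_nth q 0 = 0"
  shows "fps_nth (q_pochhammer q q n) 0 = 1"
  using assms by (induction n) (simp_all add: q_pochhammer_self_Suc)

lemma q_binomial_eq_0: "n < 0 \<or> m < n \<Longrightarrow> q_binomial q m n = 0"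
  by (auto simp: q_binomial_def)

lemma q_binomial_sym: "q_binomial q m (m - n) = q_binomial q m n"
  by (auto simp: q_binomial_def mult.commute)

text \<open>A division-free form of the definition. Later identities are proved by clearing
  denominators with it.\<close>

lemma q_binomial_mult_q_pochhammer:
  fixes q :: "'a :: field fps"
  assumes "fps_nth q 0 = 0"
  shows "q_binomial q (int (i + j)) (int i) * (q_pochhammer q q i * q_pochhammer q q j) =
           q_pochhammer q q (i + j)"
proof -
  define d where "d = q_pochhammer q q i * q_pochhammer q q j"
  have "fps_nth d 0 \<noteq> 0"
    using assms by (simp add: d_def fps_nth_0_q_pochhammer)
  then have "q_pochhammer q q (i + j) / d * d = q_pochhammer q q (i + j)"
    by (simp add: fps_divide_unit mult.assoc inverse_mult_eq_1)
  then show ?thesis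
    by (simp add: q_binomial_def d_def nat_add_distrib)
qed

lemma q_binomial_0_right:
  fixes q :: "'a :: field fps"
  assumes "fps_nth q 0 = 0"
  shows "q_binomial q (int m) 0 = 1"
proof -
  have "q_pochhammer q q m \<noteq> 0"
    using fps_nth_0_q_pochhammer[OF assms, of m] by auto
  then show ?thesis
    using q_binomial_mult_q_pochhammer[OF assms, of 0 m] by simp
qed

lemma q_binomial_self:
  fixes q :: "'a :: field fps"
  assumes "fps_nth q 0 = 0"
  shows "q_binomial q (int m) (int m) = 1"
  using q_binomial_0_right[OF assms, of m] q_binomial_sym[of q "int m" 0] by simp

lemma q_binomial_Suc:
  fixes q :: "'a :: field fps"
  assumes q: "fps_nth q 0 = 0"
  shows "q_binomial q (int (Suc m)) n =
           q_binomial q (int m) n + q ^ nat (int (Suc m) - n) * q_binomial q (int m) (n - 1)"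
proof -
  \<comment> \<open>At \<open>n = 0\<close> and \<open>n = int (Suc m)\<close> one binomial on the
    right is 0 by convention, not by the quotient formula, so these boundary cases are split
    off.\<close>
  consider "n < 0 \<or> int (Suc m) < n" | "n = 0" | "n = int (Suc m)" | "0 < n" "n \<le> int m"
    by linarith
  then show ?thesis
  proof cases
    case 1
    then show ?thesis by (auto simp: q_binomial_eq_0)
  next
    case 2
    then show ?thesis
      using q_binomial_0_right[OF q, of m] q_binomial_0_right[OF q, of "Suc m"]
      by (simp add: q_binomial_eq_0)
  next
    case 3
    then show ?thesis
      using q_binomial_self[OF q, of m] q_binomial_self[OF q, of "Suc m"]
      by (simp add: q_binomial_eq_0)
  next
    case 4
    define i j where "i = nat (n - 1)" and "j = nat (int m - n)"
    have n: "n = int (Suc i)" and m: "m = Suc (i + j)"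
      using 4 by (auto simp: i_def j_def)
    define P where "P = q_pochhammer q q"
    have P_Suc: "P (Suc l) = P l * (1 - q ^ Suc l)" for l
      by (simp add: P_def q_pochhammer_self_Suc)
    \<comment> \<open>A common denominator of all three binomials. The two of size \<open>m\<close>
      lack its last factor \<open>1 - q ^ Suc j\<close> or \<open>1 - q ^ Suc i\<close>.\<close>
    define d where "d = P (Suc i) * P (Suc j)"
    have "fps_nth d 0 = 1"
      using q by (simp add: d_def P_def fps_nth_0_q_pochhammer)
    then have "d \<noteq> 0" by auto
    have e1: "q_binomial q (int (Suc m)) n * d = P (Suc m)"
      using q_binomial_mult_q_pochhammer[OF q, of "Suc i" "Suc j"]
      by (simp add: d_def P_def n m)
    have "q_binomial q (int m) n * (P (Suc i) * P j) = P m"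
      using q_binomial_mult_q_pochhammer[OF q, of "Suc i" j]
      by (simp add: P_def n m)
    then have e2: "q_binomial q (int m) n * d = P m * (1 - q ^ Suc j)"
      by (metis d_def P_Suc mult.assoc)
    have "q_binomial q (int m) (n - 1) * (P i * P (Suc j)) = P m"
      using q_binomial_mult_q_pochhammer[OF q, of i "Suc j"]
      by (simp add: P_def n m)
    moreover have "d = P i * P (Suc j) * (1 - q ^ Suc i)"
      unfolding d_def P_Suc[of i] by (simp only: ac_simps)
    ultimately have e3: "q_binomial q (int m) (n - 1) * d = P m * (1 - q ^ Suc i)"
      by (metis mult.assoc)
    \<comment> \<open>With a = q^(j+1) and b = q^(i+1), all that remains is (1 - a) + a(1 - b) = 1 -
      ab, where ab = q^(m+1).\<close>
    have "(q_binomial q (int m) n + q ^ Suc j * q_binomial q (int m) (n - 1)) * d =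
            P m * (1 - q ^ Suc j) + q ^ Suc j * (P m * (1 - q ^ Suc i))"
      by (simp only: distrib_right mult.assoc e2 e3)
    also have "\<dots> = P m * (1 - q ^ (Suc j + Suc i))"
      unfolding power_add by (simp only: algebra_simps mult_1_left)
    also have "\<dots> = P (Suc m)"
      by (simp add: P_Suc m add.commute)
    finally have "q_binomial q (int (Suc m)) n =
        q_binomial q (int m) n + q ^ Suc j * q_binomial q (int m) (n - 1)"
      using e1 \<open>d \<noteq> 0\<close> by (metis mult_right_cancel)
    moreover have "nat (int (Suc m) - n) = Suc j"
      by (simp add: n m)
    ultimately show ?thesis by simp
  qed
qed

text \<open>The image of the first rule under the reflection of \<open>n\<close> to
  \<open>int (Suc m) - n\<close>.\<close>

lemma q_binomial_Suc':
  fixes q :: "'a :: field fps"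
  assumes "fps_nth q 0 = 0"
  shows "q_binomial q (int (Suc m)) n =
           q_binomial q (int m) (n - 1) + q ^ nat n * q_binomial q (int m) n"
  using q_binomial_Suc[OF assms, of m "int (Suc m) - n"]
    q_binomial_sym[of q "int (Suc m)" n] q_binomial_sym[of q "int m" "n - 1"]
    q_binomial_sym[of q "int m" n]
  by (simp add: algebra_simps)

section \<open>BG-rank and removal of the largest part\<close>

lemma BG_rank_Nil [simp]: "BG_rank [] = 0"
  by (simp add: BG_rank_def)

lemma BG_rank_Cons: "BG_rank (x # p) = of_bool (odd x) - BG_rank p"
proof -
  have "{i. i < length (x # p) \<and> even i \<and> odd ((x # p) ! i)} =
          (if odd x then {0} else {}) \<union> Suc ` {i. i < length p \<and> odd i \<and> odd (p ! i)}"
    (is "?A = _ \<union> Suc ` ?B")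
    by (auto simp: less_Suc_eq_0_disj image_iff)
  moreover have "{i. i < length (x # p) \<and> odd i \<and> odd ((x # p) ! i)} =
          Suc ` {i. i < length p \<and> even i \<and> odd (p ! i)}"
    by (auto simp: less_Suc_eq_0_disj image_iff)
  moreover have "card ((if odd x then {0} else {}) \<union> Suc ` ?B) = of_bool (odd x) + card ?B"
    by (subst card_Un_disjoint) (auto simp: card_image)
  ultimately show ?thesis
    by (simp add: BG_rank_def card_image)
qed

lemma BG_partitions_0: "BG_partitions 0 k = (if k = 0 then {[]} else {})"
proof -
  have "p = []" if "p \<in> BG_partitions 0 k" for p
    using that by (cases p) (auto simp: BG_partitions_def is_partition_def)
  moreover have "[] \<in> BG_partitions 0 k \<longleftrightarrow> k = 0"
    by (auto simp: BG_partitions_def is_partition_def)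
  ultimately show ?thesis by auto
qed

text \<open>The split is on whether \<open>Suc M\<close> occurs; since the list is descending, it
  can then only be the head. The term \<open>of_bool (even M)\<close> records that
  \<open>Suc M\<close> is odd.\<close>

lemma BG_partitions_Suc:
  "BG_partitions (Suc M) k =
     BG_partitions M k \<union> (#) (Suc M) ` BG_partitions M (of_bool (even M) - k)"
proof (intro equalityI subsetI)
  fix p assume p: "p \<in> BG_partitions (Suc M) k"
  show "p \<in> BG_partitions M k \<union> (#) (Suc M) ` BG_partitions M (of_bool (even M) - k)"
  proof (cases "Suc M \<in> set p")
    case False
    then show ?thesis
      using p by (fastforce simp: BG_partitions_def le_Suc_eq)
  next
    case True
    then obtain x r where [simp]: "p = x # r" by (cases p) auto
    have "x = Suc M"
      using p True by (force simp: BG_partitions_def is_partition_def)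
    \<comment> \<open>Distinctness excludes a second \<open>Suc M\<close>, so the bound on the tail
      drops to \<open>M\<close>.\<close>
    moreover have "r \<in> BG_partitions M (of_bool (even M) - k)"
      using p \<open>x = Suc M\<close>
      by (fastforce simp: BG_partitions_def is_partition_def BG_rank_Cons le_Suc_eq)
    ultimately show ?thesis by simp
  qed
next
  fix p assume "p \<in> BG_partitions M k \<union> (#) (Suc M) ` BG_partitions M (of_bool (even M) - k)"
  then show "p \<in> BG_partitions (Suc M) k"
    by (fastforce simp: BG_partitions_def is_partition_def BG_rank_Cons)
qed

section \<open>The generating function: recurrence and closed form\<close>

lemma BG_gen_0: "BG_gen 0 k q = of_bool (k = 0)"
  by (simp add: BG_gen_def BG_partitions_0)

lemma BG_gen_Suc:
  "BG_gen (Suc M) k q = BG_gen M k q + q ^ Suc M * BG_gen M (of_bool (even M) - k) q"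
proof -
  let ?C = "BG_partitions M (of_bool (even M) - k)"
  have "BG_partitions M k \<inter> (#) (Suc M) ` ?C = {}"
    by (auto simp: BG_partitions_def)
  then have "BG_gen (Suc M) k q =
      BG_gen M k q + (\<Sum>p\<in>(#) (Suc M) ` ?C. q ^ sum_list p)"
    unfolding BG_gen_def BG_partitions_Suc
    by (simp add: sum.union_disjoint finite_BG_partitions)
  also have "(\<Sum>p\<in>(#) (Suc M) ` ?C. q ^ sum_list p) = q ^ Suc M * BG_gen M (of_bool (even M) - k) q"
    by (simp add: BG_gen_def sum.reindex sum_distrib_left power_add mult.assoc)
  finally show ?thesis .
qed

text \<open>Writing \<open>M div 2\<close> treats both parities at once, so the induction can raise
  the bound by one; \<open>k\<close> varies because the recurrence reflects it.\<close>

lemma BG_gen_eq_q_binomial: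
  "BG_gen M k (fps_X :: 'a :: field fps) =
     fps_X ^ nat (2 * k\<^sup>2 - k) * q_binomial (fps_X\<^sup>2) (int M) (int (M div 2) + k)"
proof (induction M arbitrary: k)
  case 0
  show ?case
    using q_binomial_0_right[of "fps_X\<^sup>2 :: 'a fps" 0]
    by (auto simp: BG_gen_0 q_binomial_eq_0 neq_iff)
next
  case (Suc M)
  define X :: "'a fps" where "X = fps_X"
  define N where "N = M div 2"
  have X: "fps_nth (X\<^sup>2) 0 = 0" by (simp add: X_def)
  \<comment> \<open>Ensures that \<open>nat\<close> does not truncate these exponents, so they can
    be compared as integers.\<close>
  have nonneg: "0 \<le> 2 * l\<^sup>2 - l" for l :: int
  proof -
    have "l \<le> l\<^sup>2" by (smt (verit) power2_eq_square mult_le_cancel_left1 zero_le_square)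
    moreover have "0 \<le> l\<^sup>2" by simp
    ultimately show ?thesis by linarith
  qed
  note Suc = Suc.IH[folded X_def N_def]
  show ?case
  proof (cases "even M")
    case True
    then have M: "M = 2 * N" by (simp add: N_def)
    \<comment> \<open>Here \<open>Suc M div 2\<close> is still \<open>N\<close>, so \<open>b\<close>
      is the lower-index term of the first rule at \<open>int N + k\<close>.\<close>
    define b where "b = q_binomial (X\<^sup>2) (int M) (int N + k - 1)"
    have "q_binomial (X\<^sup>2) (int M) (int N + (1 - k)) = b"
      using q_binomial_sym[of "X\<^sup>2" "int M" "int N + k - 1"] by (simp add: b_def M algebra_simps)
    then have "BG_gen (Suc M) k X = X ^ nat (2 * k\<^sup>2 - k) * q_binomial (X\<^sup>2) (int M) (int N + k)
        + X ^ Suc M * (X ^ nat (2 * (1 - k)\<^sup>2 - (1 - k)) * b)"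
      using True by (simp only: BG_gen_Suc Suc of_bool_eq)
    also have "X ^ Suc M * (X ^ nat (2 * (1 - k)\<^sup>2 - (1 - k)) * b) =
        X ^ nat (2 * k\<^sup>2 - k) * ((X\<^sup>2) ^ nat (int (Suc M) - (int N + k)) * b)"
    \<comment> \<open>The exponents need to agree only where \<open>b\<close> is nonzero: this
      forces k <= N + 1, so \<open>nat\<close> is exact. Both then equal 2k^2 - 3k + 2N + 2.\<close>
    proof (cases "b = 0")
      case False
      then have "k \<le> int N + 1"
        using q_binomial_eq_0[of "int N + k - 1" "int M" "X\<^sup>2"] by (fastforce simp: b_def M)
      then have "int (Suc M + nat (2 * (1 - k)\<^sup>2 - (1 - k))) =
          int (nat (2 * k\<^sup>2 - k) + 2 * nat (int (Suc M) - (int N + k)))"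
        using nonneg[of k] nonneg[of "1 - k"] by (simp add: M power2_eq_square algebra_simps)
      then have "Suc M + nat (2 * (1 - k)\<^sup>2 - (1 - k)) =
          nat (2 * k\<^sup>2 - k) + 2 * nat (int (Suc M) - (int N + k))"
        by (simp only: of_nat_eq_iff)
      then show ?thesis
        by (metis (no_types) power_add power_mult mult.assoc)
    qed simp
    finally have "BG_gen (Suc M) k X =
        X ^ nat (2 * k\<^sup>2 - k) * q_binomial (X\<^sup>2) (int (Suc M)) (int N + k)"
      unfolding q_binomial_Suc[OF X] b_def[symmetric] by (simp only: distrib_left)
    moreover have "Suc M div 2 = N" by (simp add: M)
    ultimately show ?thesis by (simp only: X_def)
  next
    case False
    then have M: "M = 2 * N + 1" by (simp add: N_def)
    \<comment> \<open>Now \<open>Suc M div 2\<close> is \<open>N + 1\<close>, so the target index is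
      \<open>int N + 1 + k\<close>: the unreflected term has index one less, and \<open>b\<close> is
      the other term of the second rule.\<close>
    define b where "b = q_binomial (X\<^sup>2) (int M) (int N + 1 + k)"
    have "q_binomial (X\<^sup>2) (int M) (int N + (0 - k)) = b"
      using q_binomial_sym[of "X\<^sup>2" "int M" "int N + 1 + k"] by (simp add: b_def M algebra_simps)
    then have "BG_gen (Suc M) k X = X ^ nat (2 * k\<^sup>2 - k) * q_binomial (X\<^sup>2) (int M) (int N + k)
        + X ^ Suc M * (X ^ nat (2 * (0 - k)\<^sup>2 - (0 - k)) * b)"
      using False by (simp only: BG_gen_Suc Suc of_bool_eq)
    also have "X ^ Suc M * (X ^ nat (2 * (0 - k)\<^sup>2 - (0 - k)) * b) =
        X ^ nat (2 * k\<^sup>2 - k) * ((X\<^sup>2) ^ nat (int N + 1 + k) * b)"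
    \<comment> \<open>As before, nonzero \<open>b\<close> gives N + 1 + k >= 0, and both exponents
      equal 2k^2 + k + 2N + 2.\<close>
    proof (cases "b = 0")
      case False
      then have "0 \<le> int N + 1 + k"
        using q_binomial_eq_0[of "int N + 1 + k" "int M" "X\<^sup>2"] by (fastforce simp: b_def)
      then have "int (Suc M + nat (2 * (0 - k)\<^sup>2 - (0 - k))) =
          int (nat (2 * k\<^sup>2 - k) + 2 * nat (int N + 1 + k))"
        using nonneg[of k] nonneg[of "0 - k"] by (simp add: M power2_eq_square algebra_simps)
      then have "Suc M + nat (2 * (0 - k)\<^sup>2 - (0 - k)) =
          nat (2 * k\<^sup>2 - k) + 2 * nat (int N + 1 + k)"
        by (simp only: of_nat_eq_iff)
      then show ?thesis
        by (metis (no_types) power_add power_mult mult.assoc)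
    qed simp
    finally have "BG_gen (Suc M) k X =
        X ^ nat (2 * k\<^sup>2 - k) * q_binomial (X\<^sup>2) (int (Suc M)) (int N + 1 + k)"
      unfolding q_binomial_Suc'[OF X] b_def[symmetric]
      by (simp add: distrib_left algebra_simps)
    moreover have "int (Suc M div 2) = int N + 1" by (simp add: M)
    ultimately show ?thesis by (simp only: X_def)
  qed
qed

theorem theorem3p1:
  fixes N \<nu> :: nat and k :: int
  assumes "\<nu> \<in> {0, 1}"
  shows "BG_gen (2 * N + \<nu>) k (fps_X :: rat fps) =
           fps_X ^ nat (2 * k\<^sup>2 - k) * q_binomial (fps_X\<^sup>2) (int (2 * N + \<nu>)) (int N + k)"
proof -
  have "(2 * N + \<nu>) div 2 = N" using assms by auto
  then show ?thesis by (simp only: BG_gen_eq_q_binomial)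
qed

end
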